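(* Let $\mathbf{k}$ be a commutative topological ring with identity containing the field $\mathbb{Q}$ of rational numbers (no assumption is made on the topology of $\mathbf{k}$ or on topological properties of the inclusion $\mathbb{Q}\subset\mathbf{k}$). Then the group $\mathcal{J}(\mathbf{k})$ does not admit any continuous bijection into a locally compact group; that is, there is no continuous injective group homomorphism from $\mathcal{J}(\mathbf{k})$ to a locally compact group.
   Context: For a commutative topological ring $\mathbf{k}$ with identity, $\mathcal{J}(\mathbf{k})$ is the set of formal power series $f(x)=x(1+\alpha_1 x+\alpha_2x^2+\dots)$, $\alpha_n\in\mathbf{k}$; it is a group under substitution $f\circ g=f(g(x))$. It is a topological group with the product topology transported by the bijection $\mathbf{k}^{\aleph_0}\to\mathcal{J}(\mathbf{k})$, $(\alpha_1,\alpha_2,\dots)\mapsto x(1+\alpha_1x+\alpha_2x^2+\dots)$. In this terminology, a topological group $G$ admits a continuous bijection into a topological group $H$ if there exists a continuous injective group homomorphism $\phi:G\to H$ (not necessarily surjective, nor a homeomorphism onto its image). Locally compact groups are Hausdorff. *)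

theory Defs
  imports
    "HOL-Algebra.Group"
    "HOL-Analysis.Function_Topology"
    "HOL-Analysis.Abstract_Topological_Spaces"
    "HOL-Computational_Algebra.Formal_Power_Series"
begin

text \<open>
  The sequence argument is indexed from 0, so \<open>\<alpha> n\<close> is the coefficient usually written
  \<open>\<alpha>\<^sub>n\<^sub>+\<^sub>1\<close>: \<open>J_series \<alpha> = x (1 + \<alpha> 0 x + \<alpha> 1 x^2 + \<dots>)\<close>.
\<close>

definition J_series :: "(nat \<Rightarrow> 'a::comm_ring_1) \<Rightarrow> 'a fps"
  where "J_series \<alpha> = fps_X * (1 + fps_X * Abs_fps \<alpha>)"

definition J_coeffs :: "'a::comm_ring_1 fps \<Rightarrow> nat \<Rightarrow> 'a"
  where "J_coeffs f = (\<lambda>n. fps_nth f (n + 2))"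

definition J_group :: "'a::comm_ring_1 fps monoid"
  where "J_group = \<lparr>carrier = range J_series, monoid.mult = fps_compose, one = fps_X\<rparr>"

text \<open>
  The topology is not the one of the library's metric on \<^typ>\<open>'a fps\<close>, which treats the
  coefficients as discrete. As \<open>J_coeffs\<close> is the inverse of the bijection \<open>J_series\<close>,
  pulling the product topology back along it is transporting it along \<open>J_series\<close>; see
  \<open>homeomorphic_map_J_series\<close> below.
\<close>

definition J_topology :: "'a::{comm_ring_1, topological_space} fps topology"
  where "J_topology =
    pullback_topology (carrier J_group) J_coeffs (product_topology (\<lambda>_. euclidean) UNIV)"

definition topological_group :: "('g, 'm) monoid_scheme \<Rightarrow> 'g topology \<Rightarrow> bool"
  where "topological_group G T \<longleftrightarrow>
    group G \<and> topspace T = carrier G \<and>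
    continuous_map (prod_topology T T) T (\<lambda>(x, y). x \<otimes>\<^bsub>G\<^esub> y) \<and>
    continuous_map T T (\<lambda>x. inv\<^bsub>G\<^esub> x)"

definition locally_compact_group :: "('g, 'm) monoid_scheme \<Rightarrow> 'g topology \<Rightarrow> bool"
  where "locally_compact_group G T \<longleftrightarrow>
    topological_group G T \<and> Hausdorff_space T \<and> locally_compact_space T"

text \<open>Despite the name, neither surjectivity nor a homeomorphism onto the image is required.\<close>

definition admits_continuous_bijection ::
    "('g, 'm) monoid_scheme \<Rightarrow> 'g topology \<Rightarrow> ('h, 'n) monoid_scheme \<Rightarrow> 'h topology \<Rightarrow> bool"
  where "admits_continuous_bijection G S H T \<longleftrightarrow>
    (\<exists>\<phi>. \<phi> \<in> hom G H \<and> continuous_map S T \<phi> \<and> inj_on \<phi> (carrier G))"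

lemma J_coeffs_J_series [simp]: "J_coeffs (J_series \<alpha>) = \<alpha>"
  by (rule ext) (simp add: J_coeffs_def J_series_def numeral_2_eq_2)

lemma carrier_J_group: "carrier J_group = {f. fps_nth f 0 = 0 \<and> fps_nth f 1 = 1}"
proof -
  have "f = J_series (J_coeffs f)" if "fps_nth f 0 = 0" "fps_nth f 1 = 1" for f :: "'a fps"
  proof (rule fps_ext)
    fix n :: nat
    consider "n = 0" | "n = 1" | m where "n = m + 2"
      by (metis One_nat_def Suc_1 add_2_eq_Suc' not0_implies_Suc)
    then show "fps_nth f n = fps_nth (J_series (J_coeffs f)) n"
      by cases (use that in \<open>simp_all add: J_series_def J_coeffs_def numeral_2_eq_2\<close>)
  qed
  then show ?thesis
    by (auto simp: J_group_def J_series_def image_iff)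
qed

lemma homeomorphic_map_J_series:
  "homeomorphic_map (product_topology (\<lambda>_. euclidean) UNIV) J_topology
     (J_series :: (nat \<Rightarrow> 'a::{comm_ring_1, topological_space}) \<Rightarrow> 'a fps)"
proof -
  let ?P = "product_topology (\<lambda>_. euclidean :: 'a topology) (UNIV :: nat set)"
  have "continuous_map ?P J_topology J_series"
    unfolding J_topology_def
    by (rule continuous_map_pullback')
       (auto simp: o_def J_group_def)
  moreover have "continuous_map J_topology ?P J_coeffs"
    unfolding J_topology_def
    using continuous_map_pullback[of ?P ?P id] by (auto simp: o_def)
  ultimately have "homeomorphic_maps ?P J_topology J_series J_coeffs"
    by (auto simp: homeomorphic_maps_def J_topology_def topspace_pullback_topology J_group_def)
  then show ?thesis
    by (rule homeomorphic_maps_imp_map)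
qed

end

theory Submission
  imports Defs "HOL-Algebra.Coset"
begin

text \<open>
  The proof compares the filtration of \<open>\<J>(k)\<close> by order of contact with the identity and the
  behaviour of commutators in compact groups. Write \<open>J\<^sub>a\<close> for the series congruent to \<open>x\<close> modulo
  \<open>x^(a+2)\<close>. In the product topology every neighbourhood of the identity contains some \<open>J\<^sub>a\<close>
  (\<open>J_filtration_neighbourhood\<close>). Hence a continuous homomorphism
  \<open>\<phi>\<close> into a locally compact group maps some \<open>J\<^sub>n\<close> into a compact set \<open>C\<close>, and the images of the
  \<open>J\<^sub>m\<close> shrink to the identity.

  The claim is that \<open>\<phi>(J\<^sub>n)\<close> is then commutative (\<open>filtration_eventually_commutes\<close>). Two properties of
  the filtration are used: \<open>J\<^sub>a\<close> is central modulo \<open>J\<^sub>a\<^sub>+\<^sub>1\<close>, and the quotient of the two is divisible,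
  since it is the additive group of \<open>k\<close>, which contains \<open>\<rat>\<close>. Fix \<open>m\<close> and let \<open>N\<close> be the preimage of
  the closure of \<open>\<phi>(J\<^sub>m)\<close>, a normal subgroup. By downward induction on \<open>a\<close>, \<open>J\<^sub>a\<close> commutes with
  \<open>J\<^sub>n\<close> modulo \<open>N\<close>. Indeed, take \<open>x\<close> in \<open>J\<^sub>a\<close> and \<open>y\<close> in \<open>J\<^sub>n\<close>. For every \<open>j > 0\<close> there is \<open>w\<close> in
  \<open>J\<^sub>a\<close> such that \<open>x = t w^j\<close> with \<open>t\<close> in \<open>J\<^sub>a\<^sub>+\<^sub>1\<close>. By the induction hypothesis \<open>t\<close> and \<open>[w, y]\<close> commute
  modulo \<open>N\<close> with the elements of \<open>J\<^sub>n\<close>, so that, modulo \<open>N\<close>,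
  \<open>[x, y] = [w^j, y] = [w, y]^j = [w, y^j]\<close>.
  The exponent has moved from a variable element to the fixed element \<open>y\<close>. By compactness some power
  \<open>\<phi>(y)^j\<close> is as close to the identity as desired (\<open>power_recurrence\<close>), and commutators of elements of
  \<open>C\<close> with elements close to the identity are uniformly small
  (\<open>uniform_commutator_neighbourhood\<close>). So \<open>\<phi>([x, y])\<close> lies in the closure of \<open>\<phi>(J\<^sub>m)\<close>. This holds for
  all \<open>m\<close>, and in a Hausdorff group these closures meet in the identity only.

  On the other hand no \<open>J\<^sub>n\<close> is commutative (\<open>J_filtration_noncommutative\<close>), so \<open>\<phi>\<close> is not injective.
\<close>

section \<open>Commutators and powers\<close>

definition commutator :: "('g, 'm) monoid_scheme \<Rightarrow> 'g \<Rightarrow> 'g \<Rightarrow> 'g"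
  where "commutator G x y = x \<otimes>\<^bsub>G\<^esub> y \<otimes>\<^bsub>G\<^esub> inv\<^bsub>G\<^esub> (y \<otimes>\<^bsub>G\<^esub> x)"

context group
begin

lemma commutator_closed [simp]:
  "x \<in> carrier G \<Longrightarrow> y \<in> carrier G \<Longrightarrow> commutator G x y \<in> carrier G"
  by (simp add: commutator_def)

lemma commutator_eq_iff:
  assumes "x \<in> carrier G" and "y \<in> carrier G" and "d \<in> carrier G"
  shows "commutator G x y = d \<longleftrightarrow> x \<otimes> y = d \<otimes> (y \<otimes> x)"
  using assms unfolding commutator_def by (metis inv_solve_right' m_closed)

lemma commutator_eq_one_iff:
  assumes "x \<in> carrier G" and "y \<in> carrier G"
  shows "commutator G x y = \<one> \<longleftrightarrow> x \<otimes> y = y \<otimes> x"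
  using assms by (simp add: commutator_eq_iff)

lemma commute_pow:
  assumes "x \<in> carrier G" and "y \<in> carrier G" and "x \<otimes> y = y \<otimes> x"
  shows "x [^] (j::nat) \<otimes> y = y \<otimes> x [^] j"
proof (induction j)
  case (Suc j)
  have "x [^] Suc j \<otimes> y = x [^] j \<otimes> (y \<otimes> x)"
    using assms by (simp add: m_assoc)
  also have "\<dots> = y \<otimes> x [^] Suc j"
    using assms Suc by (simp flip: m_assoc)
  finally show ?case .
qed (use assms in simp)

text \<open>
  If \<open>c = [w, y]\<close> commutes with \<open>w\<close> and \<open>y\<close>, then both \<open>[w^j, y]\<close> and \<open>[w, y^j]\<close> are \<open>c^j\<close>. A factor
  that commutes with \<open>w\<close> and \<open>y\<close>, hence with \<open>c\<close>, has no influence on the commutator.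
\<close>

lemma commutator_pow_shift:
  assumes w: "w \<in> carrier G" and y: "y \<in> carrier G" and t: "t \<in> carrier G"
    and cw: "commutator G w y \<otimes> w = w \<otimes> commutator G w y"
    and cy: "commutator G w y \<otimes> y = y \<otimes> commutator G w y"
    and tw: "t \<otimes> w = w \<otimes> t" and ty: "t \<otimes> y = y \<otimes> t"
  shows "commutator G (t \<otimes> w [^] (j::nat)) y = commutator G w (y [^] j)"
proof -
  define c where "c = commutator G w y"
  have c: "c \<in> carrier G"
    using w y by (simp add: c_def)
  have wy: "w \<otimes> y = c \<otimes> (y \<otimes> w)"
    using commutator_eq_iff[OF w y c] by (simp add: c_def)
  note [simp] = w y t c
  have left: "w [^] j \<otimes> y = c [^] j \<otimes> (y \<otimes> w [^] j)" for j :: nat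
  proof (induction j)
    case (Suc j)
    have "w [^] Suc j \<otimes> y = w [^] j \<otimes> c \<otimes> (y \<otimes> w)"
      by (simp add: m_assoc wy)
    also have "w [^] j \<otimes> c = c \<otimes> w [^] j"
      using cw by (intro commute_pow) (simp_all add: c_def)
    also have "c \<otimes> w [^] j \<otimes> (y \<otimes> w) = c \<otimes> (w [^] j \<otimes> y) \<otimes> w"
      by (simp add: m_assoc)
    also have "\<dots> = (c \<otimes> c [^] j) \<otimes> (y \<otimes> w [^] Suc j)"
      unfolding Suc by (simp add: m_assoc)
    also have "c \<otimes> c [^] j = c [^] Suc j"
      by (metis c nat_pow_Suc2)
    finally show ?case .
  qed simp
  have right: "w \<otimes> y [^] j = c [^] j \<otimes> (y [^] j \<otimes> w)" for j :: nat
  proof (induction j)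
    case (Suc j)
    have "w \<otimes> y [^] Suc j = c [^] j \<otimes> y [^] j \<otimes> (w \<otimes> y)"
      using Suc by (simp add: m_assoc flip: m_assoc[of w])
    also have "\<dots> = c [^] j \<otimes> (y [^] j \<otimes> c) \<otimes> (y \<otimes> w)"
      by (simp add: wy m_assoc)
    also have "y [^] j \<otimes> c = c \<otimes> y [^] j"
      using cy by (intro commute_pow) (simp_all add: c_def)
    finally show ?case
      by (simp add: m_assoc)
  qed simp
  have "t \<otimes> c = c \<otimes> t"
  proof -
    have "t \<otimes> c \<otimes> (y \<otimes> w) = t \<otimes> w \<otimes> y"
      by (simp add: m_assoc flip: wy)
    also have "\<dots> = w \<otimes> (t \<otimes> y)"
      by (simp add: tw m_assoc)
    also have "\<dots> = c \<otimes> (y \<otimes> (w \<otimes> t))"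
      by (simp add: ty m_assoc flip: m_assoc[of w y] add: wy)
    also have "\<dots> = c \<otimes> (y \<otimes> t \<otimes> w)"
      by (simp add: m_assoc flip: tw)
    also have "\<dots> = c \<otimes> t \<otimes> (y \<otimes> w)"
      by (simp add: m_assoc flip: ty)
    finally show ?thesis
      by simp
  qed
  then have tc: "t \<otimes> c [^] j = c [^] j \<otimes> t"
    by (metis commute_pow c t)
  have "t \<otimes> w [^] j \<otimes> y = (t \<otimes> c [^] j) \<otimes> (y \<otimes> w [^] j)"
    by (simp add: m_assoc left)
  also have "\<dots> = c [^] j \<otimes> (t \<otimes> y \<otimes> w [^] j)"
    by (simp add: tc m_assoc)
  also have "\<dots> = c [^] j \<otimes> (y \<otimes> (t \<otimes> w [^] j))"
    by (simp add: ty m_assoc)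
  finally have "commutator G (t \<otimes> w [^] j) y = c [^] j"
    by (simp add: commutator_eq_iff)
  moreover have "commutator G w (y [^] j) = c [^] j"
    using right by (simp add: commutator_eq_iff)
  ultimately show ?thesis
    by simp
qed

end

lemma (in group_hom) hom_commutator:
  "x \<in> carrier G \<Longrightarrow> y \<in> carrier G \<Longrightarrow> h (commutator G x y) = commutator H (h x) (h y)"
  by (simp add: commutator_def)

text \<open>
  Where these relations hold only up to \<open>N\<close>, the identity is that of the quotient by \<open>N\<close>, in which
  membership of a commutator in \<open>N\<close> becomes a commutation relation.
\<close>

lemma (in group) commutator_pow_shift_mod:
  assumes N: "N \<lhd> G"
    and w: "w \<in> carrier G" and y: "y \<in> carrier G" and t: "t \<in> carrier G"
    and c: "commutator G (commutator G w y) w \<in> N" "commutator G (commutator G w y) y \<in> N"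
    and t': "commutator G t w \<in> N" "commutator G t y \<in> N"
  shows "commutator G (t \<otimes> w [^] (j::nat)) y \<otimes> inv (commutator G w (y [^] j)) \<in> N"
proof -
  interpret N: normal N G
    by (rule N)
  let ?\<pi> = "\<lambda>x. N #> x"
  interpret \<pi>: group_hom G "G Mod N" ?\<pi>
    by (intro group_hom.intro group_hom_axioms.intro is_group N.factorgroup_is_group N.r_coset_hom_Mod)
  have ker: "?\<pi> x = \<one>\<^bsub>G Mod N\<^esub> \<longleftrightarrow> x \<in> N" if "x \<in> carrier G" for x
    using that coset_join1 coset_join2 N.subgroup_axioms by (metis one_FactGroup)
  have comm: "?\<pi> x \<otimes>\<^bsub>G Mod N\<^esub> ?\<pi> z = ?\<pi> z \<otimes>\<^bsub>G Mod N\<^esub> ?\<pi> x"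
    if "x \<in> carrier G" "z \<in> carrier G" "commutator G x z \<in> N" for x z
    using that ker[of "commutator G x z"] \<pi>.hom_commutator[of x z]
      \<pi>.H.commutator_eq_one_iff[of "?\<pi> x" "?\<pi> z"] by simp
  have "?\<pi> (commutator G (t \<otimes> w [^] j) y) = ?\<pi> (commutator G w (y [^] j))"
    using \<pi>.H.commutator_pow_shift[of "?\<pi> w" "?\<pi> y" "?\<pi> t" j]
      comm[of "commutator G w y" w] comm[of "commutator G w y" y] comm[of t w] comm[of t y]
      w y t c t'
    by (simp add: \<pi>.hom_commutator \<pi>.hom_nat_pow del: mult_FactGroup)
  then have "?\<pi> (commutator G (t \<otimes> w [^] j) y \<otimes> inv (commutator G w (y [^] j))) = \<one>\<^bsub>G Mod N\<^esub>"
    using w y t by (simp del: mult_FactGroup one_FactGroup)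
  then show ?thesis
    using w y t by (subst ker[symmetric]) (simp_all only: commutator_closed m_closed inv_closed nat_pow_closed)
qed

section \<open>Topological groups\<close>

(* The algebraic closure operator of setoids has the same name as the topological one, which
   makes every term with a topological closure ambiguous. *)
no_notation eq_closure_of (\<open>closure'_of\<index>\<close>)

context
  fixes H :: "('h, 'm) monoid_scheme" (structure) and T :: "'h topology"
  assumes tg: "topological_group H T"
begin

interpretation group H
  using tg by (simp add: topological_group_def)

lemma topspace_topological_group: "topspace T = carrier H"
  using tg by (simp add: topological_group_def)

lemma continuous_map_group_mult:
  assumes "continuous_map X T f" and "continuous_map X T g"
  shows "continuous_map X T (\<lambda>x. f x \<otimes> g x)"
  using continuous_map_compose[of X "prod_topology T T" "\<lambda>x. (f x, g x)" T "\<lambda>(x, y). x \<otimes> y"] assms tg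
  by (simp add: topological_group_def continuous_map_pairwise o_def)

lemma continuous_map_group_inv:
  assumes "continuous_map X T f"
  shows "continuous_map X T (\<lambda>x. inv (f x))"
  using continuous_map_compose[OF assms, of T "\<lambda>x. inv x"] tg
  by (simp add: topological_group_def o_def)

text \<open>
  Division is a continuous map on the product, and the closure of \<open>S \<times> S\<close> is the product of
  the closures, so division maps the closure to itself.
\<close>

lemma subgroup_closure_of:
  assumes S: "subgroup S H"
  shows "subgroup (T closure_of S) H"
proof -
  let ?d = "\<lambda>p. fst p \<otimes> inv (snd p)"
  have "continuous_map (prod_topology T T) T ?d"
    by (intro continuous_map_group_mult continuous_map_group_inv continuous_map_fst continuous_map_snd)
  from continuous_map_image_closure_subset[OF this, of "S \<times> S"]
  have "?d ` ((T closure_of S) \<times> (T closure_of S)) \<subseteq> T closure_of (?d ` (S \<times> S))"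
    by (simp add: closure_of_Times)
  also have "\<dots> \<subseteq> T closure_of S"
    using S by (intro closure_of_mono) (auto simp: subgroup.m_closed subgroup.m_inv_closed)
  finally have div: "x \<otimes> inv y \<in> T closure_of S" if "x \<in> T closure_of S" "y \<in> T closure_of S" for x y
    using that by force
  have sub: "T closure_of S \<subseteq> carrier H"
    using closure_of_subset_topspace topspace_topological_group by metis
  have one: "\<one> \<in> T closure_of S"
    using closure_of_subset[of S T] subgroup.subset[OF S] subgroup.one_closed[OF S]
      topspace_topological_group by auto
  have inv: "inv x \<in> T closure_of S" if "x \<in> T closure_of S" for x
    using div[OF one that] l_one[OF inv_closed[OF subsetD[OF sub that]]] by simp
  show ?thesis
  proof (rule subgroupI)
    fix x y
    assume "x \<in> T closure_of S" "y \<in> T closure_of S"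
    then show "x \<otimes> y \<in> T closure_of S"
      using div[of x "inv y"] inv[of y] sub by (metis inv_inv subsetD)
  qed (use sub one inv in auto)
qed

lemma conjugation_closure_of:
  assumes x: "x \<in> carrier H" and S: "\<And>s. s \<in> S \<Longrightarrow> x \<otimes> s \<otimes> inv x \<in> S"
    and s: "s \<in> T closure_of S"
  shows "x \<otimes> s \<otimes> inv x \<in> T closure_of S"
proof -
  have "continuous_map T T (\<lambda>s. x \<otimes> s \<otimes> inv x)"
    using x by (intro continuous_map_group_mult) (auto simp: topspace_topological_group)
  from continuous_map_image_closure_subset[OF this, of S]
  have "(\<lambda>s. x \<otimes> s \<otimes> inv x) ` (T closure_of S) \<subseteq> T closure_of ((\<lambda>s. x \<otimes> s \<otimes> inv x) ` S)" .
  also have "\<dots> \<subseteq> T closure_of S"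
    using S by (intro closure_of_mono) auto
  finally show ?thesis
    using s by blast
qed

text \<open>
  The powers of \<open>y\<close> lie in a compact set, which is covered by finitely many open sets \<open>V\<close> with
  \<open>V V\<^sup>-\<^sup>1\<close> contained in \<open>W\<close>. Two different powers fall into the same one, and their quotient is
  the required power.
\<close>

lemma power_recurrence:
  assumes C: "compactin T C" and y: "y \<in> carrier H" and pow: "\<And>j::nat. y [^] j \<in> C"
    and W: "openin T W" "\<one> \<in> W"
  shows "\<exists>j::nat. 0 < j \<and> y [^] j \<in> W"
proof -
  let ?d = "\<lambda>p. fst p \<otimes> inv (snd p)"
  let ?D = "{p \<in> topspace (prod_topology T T). ?d p \<in> W}"
  have Csub: "C \<subseteq> carrier H"
    using compactin_subset_topspace[OF C] topspace_topological_group by simp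
  have "continuous_map (prod_topology T T) T ?d"
    by (intro continuous_map_group_mult continuous_map_group_inv continuous_map_fst continuous_map_snd)
  then have D: "openin (prod_topology T T) ?D"
    using W(1) by (rule openin_continuous_map_preimage)
  have "\<exists>V. openin T V \<and> c \<in> V \<and> V \<times> V \<subseteq> ?D" if "c \<in> C" for c
  proof -
    have "(c, c) \<in> ?D"
      using that Csub W(2) by (auto simp: topspace_topological_group)
    then obtain U V where "openin T U" "openin T V" "c \<in> U" "c \<in> V" "U \<times> V \<subseteq> ?D"
      using D[unfolded openin_prod_topology_alt] by meson
    then show ?thesis
      by (intro exI[of _ "U \<inter> V"]) auto
  qed
  then have "\<exists>V. \<forall>c\<in>C. openin T (V c) \<and> c \<in> V c \<and> V c \<times> V c \<subseteq> ?D"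
    by (intro bchoice) blast
  then obtain V where V: "\<And>c. c \<in> C \<Longrightarrow> openin T (V c) \<and> c \<in> V c \<and> V c \<times> V c \<subseteq> ?D"
    by blast
  have "\<exists>\<F>. finite \<F> \<and> \<F> \<subseteq> V ` C \<and> C \<subseteq> \<Union>\<F>"
    by (rule compactinD[OF C]) (use V in blast)+
  then obtain \<F> where F: "finite \<F>" "\<F> \<subseteq> V ` C" "C \<subseteq> \<Union>\<F>"
    by blast
  have "\<exists>Q. Q \<in> \<F> \<and> y [^] j \<in> Q" for j :: nat
    using F(3) pow[of j] by blast
  then obtain U where U: "\<And>j::nat. U j \<in> \<F> \<and> y [^] j \<in> U j"
    by metis
  have "\<not> inj U"
    using F(1) U by (metis finite_imageD finite_subset image_subsetI infinite_UNIV_nat)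
  then obtain i k where ik: "i < k" "U i = U k"
    by (metis injI linorder_neqE_nat)
  obtain c where c: "c \<in> C" "U k = V c"
    using U[of k] F(2) by blast
  then have "(y [^] k, y [^] i) \<in> V c \<times> V c"
    using U[of k] U[of i] ik(2) by auto
  then have "y [^] k \<otimes> inv (y [^] i) \<in> W"
    using V[OF c(1)] by auto
  moreover have "y [^] k = y [^] (k - i) \<otimes> y [^] i"
    using y ik(1) by (simp add: nat_pow_mult)
  ultimately have "y [^] (k - i) \<in> W"
    using y by (simp add: m_assoc)
  then show ?thesis
    using ik(1) by (intro exI[of _ "k - i"]) simp
qed

text \<open>
  Commutators with the identity are trivial, so the preimage of \<open>V\<close> under the commutator map is
  an open set containing \<open>C \<times> {1}\<close>. As \<open>C\<close> is compact, this open set contains some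
  \<open>C \<times> W\<close> with \<open>W\<close> a neighbourhood of the identity.
\<close>

lemma uniform_commutator_neighbourhood:
  assumes C: "compactin T C" and V: "openin T V" "\<one> \<in> V"
  shows "\<exists>W. openin T W \<and> \<one> \<in> W \<and> (\<forall>c\<in>C. \<forall>w\<in>W. commutator H c w \<in> V)"
proof -
  let ?c = "\<lambda>p. commutator H (fst p) (snd p)"
  let ?D = "{p \<in> topspace (prod_topology T T). ?c p \<in> V}"
  have Csub: "C \<subseteq> carrier H"
    using compactin_subset_topspace[OF C] topspace_topological_group by simp
  have "continuous_map (prod_topology T T) T ?c"
    unfolding commutator_def
    by (intro continuous_map_group_mult continuous_map_group_inv continuous_map_fst continuous_map_snd)
  then have D: "openin (prod_topology T T) ?D"
    using V(1) by (rule openin_continuous_map_preimage)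
  have "commutator H c \<one> = \<one>" if "c \<in> C" for c
    using that Csub by (subst commutator_eq_one_iff) auto
  then have CD: "C \<times> {\<one>} \<subseteq> ?D"
    using V(2) Csub by (auto simp: topspace_topological_group)
  have one: "compactin T {\<one>}"
    by (simp add: topspace_topological_group)
  obtain A W where "openin T W" "C \<subseteq> A" "{\<one>} \<subseteq> W" "A \<times> W \<subseteq> ?D"
    by (rule Wallace_theorem_prod_topology[OF C one D CD])
  then show ?thesis
    by (intro exI[of _ W]) force
qed

lemma closure_of_memI:
  assumes N: "subgroup N H" and g: "g \<in> carrier H"
    and near: "\<And>V. openin T V \<Longrightarrow> \<one> \<in> V \<Longrightarrow> \<exists>v\<in>V. g \<otimes> inv v \<in> N"
  shows "g \<in> T closure_of N"
  unfolding in_closure_of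
proof (intro conjI allI impI)
  fix Q
  assume Q: "g \<in> Q \<and> openin T Q"
  have "continuous_map T T (\<lambda>v. g \<otimes> inv v)"
    using g by (intro continuous_map_group_mult continuous_map_group_inv)
      (auto simp: topspace_topological_group)
  then have "openin T {v \<in> topspace T. g \<otimes> inv v \<in> Q}"
    using Q openin_continuous_map_preimage by blast
  moreover have "\<one> \<in> {v \<in> topspace T. g \<otimes> inv v \<in> Q}"
    using Q g by (simp add: topspace_topological_group)
  ultimately show "\<exists>q. q \<in> N \<and> q \<in> Q"
    using near by blast
qed (use g topspace_topological_group in simp)

end

section \<open>Filtered groups mapping to locally compact groups\<close>

text \<open>
  The source is a bare group: all that is kept of its topology is that the
  subgroups \<open>F m\<close> become small in \<open>H\<close>. The index \<open>n\<close> is one for which the image of \<open>F n\<close> lies in a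
  compact neighbourhood of the identity.
\<close>

theorem filtration_eventually_commutes:
  fixes G :: "('g, 'm) monoid_scheme" and H :: "('h, 'n) monoid_scheme"
  assumes G: "group G" and H: "locally_compact_group H T" and \<phi>: "\<phi> \<in> hom G H"
    and sub: "\<And>a. subgroup (F a) G"
    and central: "\<And>a x y. x \<in> F a \<Longrightarrow> y \<in> carrier G \<Longrightarrow> commutator G x y \<in> F (Suc a)"
    and decr: "\<And>a. F (Suc a) \<subseteq> F a"
    and divisible: "\<And>a x j. x \<in> F a \<Longrightarrow> 0 < (j::nat) \<Longrightarrow>
      \<exists>w\<in>F a. x \<otimes>\<^bsub>G\<^esub> inv\<^bsub>G\<^esub> (w [^]\<^bsub>G\<^esub> j) \<in> F (Suc a)"
    and small: "\<And>U. openin T U \<Longrightarrow> \<one>\<^bsub>H\<^esub> \<in> U \<Longrightarrow> \<exists>m. \<phi> ` F m \<subseteq> U"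
  shows "\<exists>n. \<forall>x\<in>F n. \<forall>y\<in>F n. \<phi> (x \<otimes>\<^bsub>G\<^esub> y) = \<phi> (y \<otimes>\<^bsub>G\<^esub> x)"
proof -
  have tg: "topological_group H T" and T2: "Hausdorff_space T" and lc: "locally_compact_space T"
    using H by (simp_all add: locally_compact_group_def)
  interpret H: group H
    using tg by (simp add: topological_group_def)
  interpret \<phi>: group_hom G H \<phi>
    using G \<phi> by (simp add: group_hom_def group_hom_axioms_def)
  note top = topspace_topological_group[OF tg]
  have F_carrier: "x \<in> carrier G" if "x \<in> F a" for x a
    using that subgroup.subset[OF sub] by blast
  have F_anti: "F b \<subseteq> F a" if "a \<le> b" for a b
    using that decr by (rule lift_Suc_antimono_le[rotated])
  obtain U C where U: "openin T U" "\<one>\<^bsub>H\<^esub> \<in> U" and C: "compactin T C" "U \<subseteq> C"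
    using lc top H.one_closed unfolding locally_compact_space_def by metis
  obtain n where n: "\<phi> ` F n \<subseteq> C"
    using small[OF U] C(2) by blast
  (* Elements that cannot be distinguished from 1 up to elements of F m by the topology of H. *)
  define N where "N m = {g \<in> carrier G. \<phi> g \<in> T closure_of (\<phi> ` F m)}" for m
  have img: "subgroup (\<phi> ` F m) H" for m
    using sub by (rule \<phi>.subgroup_img_is_subgroup)
  have closure: "subgroup (T closure_of (\<phi> ` F m)) H" for m
    using tg img by (rule subgroup_closure_of)
  have F_N: "F m \<subseteq> N m" for m
    using closure_of_subset[of "\<phi> ` F m" T] subgroup.subset[OF img] F_carrier
    unfolding N_def top by blast
  have normal: "N m \<lhd> G" for m
  proof (rule \<phi>.G.normal_invI)
    interpret K: subgroup "T closure_of (\<phi> ` F m)" H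
      by (rule closure)
    show "subgroup (N m) G"
      by (rule \<phi>.G.subgroupI) (auto simp: N_def intro!: exI[of _ "\<one>\<^bsub>G\<^esub>"])
    have conj: "g \<otimes>\<^bsub>G\<^esub> s \<otimes>\<^bsub>G\<^esub> inv\<^bsub>G\<^esub> g \<in> F m" if g: "g \<in> carrier G" and s: "s \<in> F m" for g s
    proof -
      note sG = F_carrier[OF s]
      have "commutator G s g \<in> F m"
        using central[OF s g] decr by blast
      then have "inv\<^bsub>G\<^esub> (commutator G s g) \<otimes>\<^bsub>G\<^esub> s \<in> F m"
        using s sub by (meson subgroup.m_closed subgroup.m_inv_closed)
      also have "inv\<^bsub>G\<^esub> (commutator G s g) \<otimes>\<^bsub>G\<^esub> s = g \<otimes>\<^bsub>G\<^esub> s \<otimes>\<^bsub>G\<^esub> inv\<^bsub>G\<^esub> g"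
        using g sG by (simp add: commutator_def \<phi>.G.inv_mult_group \<phi>.G.m_assoc)
      finally show ?thesis .
    qed
    fix g x
    assume g: "g \<in> carrier G" and x: "x \<in> N m"
    have "\<phi> g \<otimes>\<^bsub>H\<^esub> s \<otimes>\<^bsub>H\<^esub> inv\<^bsub>H\<^esub> (\<phi> g) \<in> \<phi> ` F m" if "s \<in> \<phi> ` F m" for s
    proof -
      obtain f where f: "f \<in> F m" "s = \<phi> f"
        using \<open>s \<in> \<phi> ` F m\<close> by blast
      then have "\<phi> g \<otimes>\<^bsub>H\<^esub> s \<otimes>\<^bsub>H\<^esub> inv\<^bsub>H\<^esub> (\<phi> g) = \<phi> (g \<otimes>\<^bsub>G\<^esub> f \<otimes>\<^bsub>G\<^esub> inv\<^bsub>G\<^esub> g)"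
        using g F_carrier by simp
      then show ?thesis
        using conj[OF g f(1)] by simp
    qed
    then show "g \<otimes>\<^bsub>G\<^esub> x \<otimes>\<^bsub>G\<^esub> inv\<^bsub>G\<^esub> g \<in> N m"
      using conjugation_closure_of[OF tg, of "\<phi> g" "\<phi> ` F m" "\<phi> x"] g x by (simp add: N_def)
  qed
  have step_down: "commutator G x y \<in> N m"
    if IH: "\<And>x y. x \<in> F (Suc a) \<Longrightarrow> y \<in> F n \<Longrightarrow> commutator G x y \<in> N m"
      and a: "n \<le> a" and x: "x \<in> F a" and y: "y \<in> F n" for a m x y
  proof -
    note xG = F_carrier[OF x] and yG = F_carrier[OF y]
    (* The commutator is an element of the closure of F m up to an arbitrarily small factor,
       so it lies in the closure of that closure, which is the same set. *)
    have "\<phi> (commutator G x y) \<in> T closure_of (T closure_of (\<phi> ` F m))"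
    proof (rule closure_of_memI[OF tg closure])
      fix V
      assume "openin T V" "\<one>\<^bsub>H\<^esub> \<in> V"
      then obtain W where W: "openin T W" "\<one>\<^bsub>H\<^esub> \<in> W" "\<And>c w. c \<in> C \<Longrightarrow> w \<in> W \<Longrightarrow> commutator H c w \<in> V"
        using uniform_commutator_neighbourhood[OF tg C(1)] by metis
      have "\<phi> y [^]\<^bsub>H\<^esub> j \<in> C" for j :: nat
      proof -
        have "y [^]\<^bsub>G\<^esub> j \<in> F n"
          by (induction j) (use y sub[of n] in \<open>auto intro: subgroup.one_closed subgroup.m_closed\<close>)
        then show ?thesis
          using n yG by (auto simp flip: \<phi>.hom_nat_pow)
      qed
      then obtain j :: nat where j: "0 < j" "\<phi> y [^]\<^bsub>H\<^esub> j \<in> W"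
        using power_recurrence[OF tg C(1) _ _ W(1,2), of "\<phi> y"] yG by auto
      (* The exponent is dictated by y, V and C; divisibility provides a root of x for it. *)
      obtain w where w: "w \<in> F a" and t: "x \<otimes>\<^bsub>G\<^esub> inv\<^bsub>G\<^esub> (w [^]\<^bsub>G\<^esub> j) \<in> F (Suc a)"
        using divisible[OF x j(1)] by blast
      define t where "t = x \<otimes>\<^bsub>G\<^esub> inv\<^bsub>G\<^esub> (w [^]\<^bsub>G\<^esub> j)"
      have tF: "t \<in> F (Suc a)"
        using t by (simp add: t_def)
      note wG = F_carrier[OF w] and tG = F_carrier[OF tF]
      have wn: "w \<in> F n"
        using w F_anti[OF a] by blast
      have x_eq: "x = t \<otimes>\<^bsub>G\<^esub> w [^]\<^bsub>G\<^esub> j"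
        using xG wG by (simp add: t_def \<phi>.G.m_assoc)
      have c: "commutator G w y \<in> F (Suc a)"
        using central[OF w yG] .
      have "commutator G x y \<otimes>\<^bsub>G\<^esub> inv\<^bsub>G\<^esub> (commutator G w (y [^]\<^bsub>G\<^esub> j)) \<in> N m"
        unfolding x_eq
        using IH[OF c wn] IH[OF c y] IH[OF tF wn] IH[OF tF y]
        by (intro \<phi>.G.commutator_pow_shift_mod[OF normal wG yG tG])
      then have "\<phi> (commutator G x y) \<otimes>\<^bsub>H\<^esub> inv\<^bsub>H\<^esub> (commutator H (\<phi> w) (\<phi> y [^]\<^bsub>H\<^esub> j))
          \<in> T closure_of (\<phi> ` F m)"
        using xG yG wG by (simp add: N_def \<phi>.hom_commutator \<phi>.hom_nat_pow)
      moreover have "commutator H (\<phi> w) (\<phi> y [^]\<^bsub>H\<^esub> j) \<in> V"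
        using n wn by (intro W(3) j(2)) auto
      ultimately show "\<exists>v\<in>V. \<phi> (commutator G x y) \<otimes>\<^bsub>H\<^esub> inv\<^bsub>H\<^esub> v \<in> T closure_of (\<phi> ` F m)"
        by blast
    qed (use xG yG in simp)
    then show ?thesis
      using xG yG by (simp add: N_def)
  qed
  have comm_N: "commutator G x y \<in> N m" if xy: "x \<in> F n" "y \<in> F n" for x y m
  proof (cases "n \<le> m")
    case True
    define P where "P a \<longleftrightarrow> (\<forall>x\<in>F a. \<forall>y\<in>F n. commutator G x y \<in> N m)" for a
    have "P n"
      using True
    proof (induction rule: inc_induct)
      case base
      show ?case
        unfolding P_def using central decr F_N F_carrier by blast
    next
      case (step a)
      then show ?case
        unfolding P_def using step_down[of a m] by blast
    qed
    then show ?thesis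
      unfolding P_def using xy by blast
  next
    case False
    then have "commutator G x y \<in> F m"
      using central[OF xy(1) F_carrier[OF xy(2)]] F_anti[of m "Suc n"] by auto
    then show ?thesis
      using F_N by blast
  qed
  have "commutator H (\<phi> x) (\<phi> y) = \<one>\<^bsub>H\<^esub>" if xy: "x \<in> F n" "y \<in> F n" for x y
  proof (rule ccontr)
    note xG = F_carrier[OF xy(1)] and yG = F_carrier[OF xy(2)]
    assume ne: "commutator H (\<phi> x) (\<phi> y) \<noteq> \<one>\<^bsub>H\<^esub>"
    then obtain A B where A: "openin T A" "commutator H (\<phi> x) (\<phi> y) \<in> A"
      and B: "openin T B" "\<one>\<^bsub>H\<^esub> \<in> B" and AB: "disjnt A B"
      using T2 xG yG unfolding Hausdorff_space_def top
      by (metis H.commutator_closed H.one_closed \<phi>.hom_closed)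
    obtain m where m: "\<phi> ` F m \<subseteq> B"
      using small[OF B] by blast
    have "\<phi> (commutator G x y) \<in> T closure_of (\<phi> ` F m)"
      using comm_N[OF xy, of m] by (simp add: N_def)
    then obtain z where "z \<in> \<phi> ` F m" "z \<in> A"
      using A xG yG unfolding in_closure_of by (metis \<phi>.hom_commutator)
    then show False
      using m AB by (auto simp: disjnt_iff)
  qed
  then have "\<phi> (x \<otimes>\<^bsub>G\<^esub> y) = \<phi> (y \<otimes>\<^bsub>G\<^esub> x)" if "x \<in> F n" "y \<in> F n" for x y
    using that F_carrier H.commutator_eq_one_iff[of "\<phi> x" "\<phi> y"] by simp
  then show ?thesis
    by blast
qed

section \<open>Substitution over commutative rings\<close>

lemma fps_compose_nth_atMost:
  fixes c :: "'a::comm_ring_1 fps"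
  assumes "fps_nth c 0 = 0" and "n \<le> N"
  shows "fps_nth (a oo c) n = (\<Sum>i=0..N. fps_nth a i * fps_nth (c ^ i) n)"
  unfolding fps_compose_nth
  by (rule sum.mono_neutral_left) (use assms startsby_zero_power_prefix[of c] in auto)

text \<open>
  Zero divisors are allowed among the coefficients. Both sides have as \<open>n\<close>-th coefficient the sum of
  \<open>a\<^sub>i b\<^sub>k (c^(i+k))\<^sub>n\<close> over all \<open>i\<close> and \<open>k\<close>, where the terms with \<open>i + k > n\<close> vanish.
\<close>

lemma fps_compose_mult_distrib_comm_ring:
  fixes c :: "'a::comm_ring_1 fps"
  assumes c0: "fps_nth c 0 = 0"
  shows "(a * b) oo c = (a oo c) * (b oo c)"
proof (rule fps_ext)
  fix n
  let ?a = "fps_nth a" and ?b = "fps_nth b"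
  have "fps_nth ((a oo c) * (b oo c)) n =
      (\<Sum>j=0..n. (\<Sum>i=0..n. ?a i * fps_nth (c ^ i) j) * (\<Sum>k=0..n. ?b k * fps_nth (c ^ k) (n - j)))"
    unfolding fps_mult_nth by (intro sum.cong refl) (simp add: fps_compose_nth_atMost[OF c0, of _ n])
  also have "\<dots> = (\<Sum>j=0..n. \<Sum>(i, k)\<in>{0..n} \<times> {0..n}.
      ?a i * ?b k * (fps_nth (c ^ i) j * fps_nth (c ^ k) (n - j)))"
    unfolding sum_product sum.cartesian_product by (intro sum.cong refl) (auto simp: mult_ac)
  also have "\<dots> = (\<Sum>(i, k)\<in>{0..n} \<times> {0..n}. ?a i * ?b k * fps_nth (c ^ (i + k)) n)"
    by (subst sum.swap) (simp add: fps_mult_nth power_add sum_distrib_left case_prod_unfold)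
  also have "\<dots> = (\<Sum>(i, k)\<in>{(i, k). i + k \<le> n}. ?a i * ?b k * fps_nth (c ^ (i + k)) n)"
  proof (rule sum.mono_neutral_right)
    show "\<forall>p\<in>{0..n} \<times> {0..n} - {(i, k). i + k \<le> n}.
        (case p of (i, k) \<Rightarrow> ?a i * ?b k * fps_nth (c ^ (i + k)) n) = 0"
    proof
      fix p
      assume "p \<in> {0..n} \<times> {0..n} - {(i, k). i + k \<le> n}"
      then have "n < fst p + snd p"
        by (auto simp: case_prod_unfold)
      then show "(case p of (i, k) \<Rightarrow> ?a i * ?b k * fps_nth (c ^ (i + k)) n) = 0"
        using startsby_zero_power_prefix[OF c0] by (simp add: case_prod_unfold)
    qed
  qed auto
  also have "\<dots> = fps_nth ((a * b) oo c) n"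
    using sum_pair_less_iff[of ?a ?b "\<lambda>s. fps_nth (c ^ s) n" n]
    by (simp add: fps_compose_nth fps_mult_nth sum_distrib_right case_prod_unfold)
  finally show "fps_nth ((a * b) oo c) n = fps_nth ((a oo c) * (b oo c)) n" ..
qed

lemma fps_compose_power_comm_ring:
  fixes c :: "'a::comm_ring_1 fps"
  assumes "fps_nth c 0 = 0"
  shows "(a ^ n) oo c = (a oo c) ^ n"
  by (induction n) (simp_all add: fps_compose_mult_distrib_comm_ring[OF assms])

lemma fps_compose_assoc_comm_ring:
  fixes b c :: "'a::comm_ring_1 fps"
  assumes b0: "fps_nth b 0 = 0" and c0: "fps_nth c 0 = 0"
  shows "(a oo b) oo c = a oo (b oo c)"
proof (rule fps_ext)
  fix n
  have "fps_nth ((a oo b) oo c) n =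
      (\<Sum>i=0..n. \<Sum>k=0..n. fps_nth a k * (fps_nth (b ^ k) i * fps_nth (c ^ i) n))"
    unfolding fps_compose_nth[of "a oo b"]
    by (intro sum.cong refl)
       (simp add: fps_compose_nth_atMost[OF b0, of _ n] sum_distrib_right mult.assoc)
  also have "\<dots> = (\<Sum>k=0..n. fps_nth a k * fps_nth ((b oo c) ^ k) n)"
    by (subst sum.swap)
       (simp add: fps_compose_nth sum_distrib_left flip: fps_compose_power_comm_ring[OF c0])
  finally show "fps_nth ((a oo b) oo c) n = fps_nth (a oo (b oo c)) n"
    by (simp add: fps_compose_nth[of a])
qed

lemma fps_nth_power_leading:
  fixes f :: "'a::comm_ring_1 fps"
  assumes "f \<in> carrier J_group"
  shows "fps_nth (f ^ n) n = 1"
  using assms startsby_zero_power_nth_same[of f n] by (simp add: carrier_J_group)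

text \<open>
  The \<open>n\<close>-th coefficient of \<open>g(f(x))\<close> is \<open>g\<^sub>n\<close> plus terms in the earlier coefficients of \<open>g\<close>, because
  \<open>f^n\<close> starts with \<open>x^n\<close>. This determines a left inverse \<open>g\<close> recursively, without any division.
\<close>

fun left_compinv_coeff :: "'a::comm_ring_1 fps \<Rightarrow> nat \<Rightarrow> 'a"
  where "left_compinv_coeff f n =
    fps_nth fps_X n - (\<Sum>i<n. left_compinv_coeff f i * fps_nth (f ^ i) n)"

declare left_compinv_coeff.simps [simp del]

lemma left_compinv_exists:
  fixes f :: "'a::comm_ring_1 fps"
  assumes f: "f \<in> carrier J_group"
  obtains g where "g \<in> carrier J_group" and "g oo f = fps_X"
proof
  let ?g = "Abs_fps (left_compinv_coeff f)"
  have "fps_nth (?g oo f) n = fps_nth fps_X n" for n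
  proof -
    have "fps_nth (?g oo f) n =
        (\<Sum>i<n. left_compinv_coeff f i * fps_nth (f ^ i) n) + left_compinv_coeff f n"
      using fps_nth_power_leading[OF f]
      by (simp add: fps_compose_nth atLeast0AtMost flip: lessThan_Suc_atMost)
    then show ?thesis
      by (simp add: left_compinv_coeff.simps[of f n])
  qed
  then show "?g oo f = fps_X"
    by (intro fps_ext) simp
  have "left_compinv_coeff f 0 = 0"
    by (subst left_compinv_coeff.simps) simp
  moreover from this have "left_compinv_coeff f 1 = 1"
    by (subst left_compinv_coeff.simps) simp
  ultimately show "?g \<in> carrier J_group"
    by (simp add: carrier_J_group)
qed

lemma one_J_group [simp]: "\<one>\<^bsub>J_group\<^esub> = fps_X"
  and mult_J_group [simp]: "f \<otimes>\<^bsub>J_group\<^esub> g = f oo g"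
  by (simp_all add: J_group_def)

lemma group_J_group: "group (J_group :: 'a::comm_ring_1 fps monoid)"
proof (rule groupI)
  fix f g h :: "'a fps"
  assume f: "f \<in> carrier J_group" and g: "g \<in> carrier J_group"
  then show "f \<otimes>\<^bsub>J_group\<^esub> g \<in> carrier J_group"
    by (simp add: carrier_J_group fps_compose_nth)
  assume "h \<in> carrier J_group"
  with f g show "f \<otimes>\<^bsub>J_group\<^esub> g \<otimes>\<^bsub>J_group\<^esub> h = f \<otimes>\<^bsub>J_group\<^esub> (g \<otimes>\<^bsub>J_group\<^esub> h)"
    by (simp add: carrier_J_group fps_compose_assoc_comm_ring)
next
  fix f :: "'a fps"
  assume f: "f \<in> carrier J_group"
  show "\<one>\<^bsub>J_group\<^esub> \<otimes>\<^bsub>J_group\<^esub> f = f"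
    using f by (auto simp: carrier_J_group fps_X_fps_compose intro!: fps_ext)
  show "\<exists>g\<in>carrier J_group. g \<otimes>\<^bsub>J_group\<^esub> f = \<one>\<^bsub>J_group\<^esub>"
    by (rule left_compinv_exists[OF f]) auto
qed (simp add: carrier_J_group)

section \<open>The filtration of the substitution group\<close>

text \<open>
  The series congruent to \<open>x\<close> modulo \<open>x^(a+2)\<close>. The index is shifted such that \<open>a = 0\<close> gives the
  whole group and \<open>x^(a+2)\<close> is the first term that may differ.
\<close>

definition J_filtration :: "nat \<Rightarrow> 'a::comm_ring_1 fps set"
  where "J_filtration a = {f \<in> carrier J_group. \<forall>i\<le>Suc a. fps_nth f i = fps_nth fps_X i}"

lemma J_filtration_carrier: "f \<in> J_filtration a \<Longrightarrow> f \<in> carrier J_group"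
  by (simp add: J_filtration_def)

lemma J_filtration_Suc_subset: "J_filtration (Suc a) \<subseteq> J_filtration a"
  by (auto simp: J_filtration_def)

lemma J_filtration_Suc_iff:
  "f \<in> J_filtration (Suc a) \<longleftrightarrow>
    f \<in> J_filtration a \<and> fps_nth f (Suc (Suc a)) = fps_nth fps_X (Suc (Suc a))"
  by (auto simp: J_filtration_def le_Suc_eq)

text \<open>
  Write \<open>g = x (1 + x^(a+1) h)\<close>. Then \<open>g^k\<close> differs from \<open>x^k\<close> by a multiple of \<open>x^(k+a+1)\<close>, which
  for \<open>k \<ge> 2\<close> is beyond the coefficients in question.
\<close>

lemma fps_nth_power_J_filtration:
  fixes g :: "'a::comm_ring_1 fps"
  assumes g: "g \<in> J_filtration a" and "2 \<le> k" and "i \<le> Suc (Suc a)"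
  shows "fps_nth (g ^ k) i = fps_nth (fps_X ^ k) i"
proof -
  define h where "h = Abs_fps (\<lambda>i. fps_nth g (Suc (Suc a) + i))"
  have "fps_nth g n = fps_nth (fps_X * (1 + fps_X ^ Suc a * h)) n" for n
  proof (cases n)
    case (Suc m)
    then show ?thesis
      using g by (auto simp: h_def J_filtration_def fps_X_power_mult_nth carrier_J_group simp del: power_Suc)
  qed (use g in \<open>simp add: J_filtration_def carrier_J_group del: power_Suc\<close>)
  then have "g = fps_X * (1 + fps_X ^ Suc a * h)"
    by (rule fps_ext)
  moreover have "(1 + fps_X ^ Suc a * h) ^ k =
      1 + fps_X ^ Suc a * (h * (\<Sum>i<k. (1 + fps_X ^ Suc a * h) ^ i))" (is "_ = 1 + _ * ?h'")
    using power_diff_1_eq[of "1 + fps_X ^ Suc a * h" k]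
    by (simp add: diff_eq_eq mult.assoc add.commute del: power_Suc)
  ultimately have "g ^ k = fps_X ^ k * (1 + fps_X ^ Suc a * ?h')"
    by (metis power_mult_distrib)
  then have "g ^ k = fps_X ^ k + fps_X ^ (k + Suc a) * ?h'"
    by (simp only: power_add distrib_left mult.assoc mult_1_right)
  then show ?thesis
    using assms(2,3) by (simp add: fps_X_power_mult_nth del: power_Suc)
qed

text \<open>
  To first order, substitution is addition of the deviations from \<open>x\<close>. The right-hand side is symmetric
  in \<open>f\<close> and \<open>g\<close>, so each step of the filtration is central modulo the next one, and the
  coefficient of \<open>x^(a+2)\<close> is additive on the step \<open>a\<close>.
\<close>

lemma fps_nth_compose_J_filtration:
  fixes f g :: "'a::comm_ring_1 fps"
  assumes f: "f \<in> carrier J_group" and g: "g \<in> carrier J_group"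
    and fg: "f \<in> J_filtration a \<or> g \<in> J_filtration a" and i: "i \<le> Suc (Suc a)"
  shows "fps_nth (f oo g) i = fps_nth f i + fps_nth g i - fps_nth fps_X i"
  using fg
proof
  assume fa: "f \<in> J_filtration a"
  (* f - x starts at x^(a+2), so the only power of g that contributes is the i-th one. *)
  have "fps_nth ((f - fps_X) oo g) i = (\<Sum>k\<in>{i}. fps_nth (f - fps_X) k * fps_nth (g ^ k) i)"
    unfolding fps_compose_nth
    by (rule sum.mono_neutral_right) (use fa i in \<open>auto simp: J_filtration_def\<close>)
  then have "fps_nth ((f - fps_X) oo g) i = fps_nth f i - fps_nth fps_X i"
    by (simp add: fps_nth_power_leading[OF g])
  moreover have "fps_X oo g = g"
    using group.is_monoid[OF group_J_group, THEN monoid.l_one, OF g] by simp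
  ultimately show ?thesis
    by (simp add: fps_compose_sub_distrib algebra_simps)
next
  assume ga: "g \<in> J_filtration a"
  (* Powers of g other than the first one agree with those of x in the relevant degrees. *)
  have "fps_nth (f oo g) i - fps_nth (f oo fps_X) i =
      (\<Sum>k=0..i. fps_nth f k * (fps_nth (g ^ k) i - fps_nth (fps_X ^ k) i))"
    unfolding fps_compose_nth by (simp add: algebra_simps sum_subtractf)
  also have "\<dots> = (\<Sum>k\<in>{0..i} \<inter> {1}. fps_nth f k * (fps_nth (g ^ k) i - fps_nth (fps_X ^ k) i))"
  proof (rule sum.mono_neutral_right)
    show "\<forall>k\<in>{0..i} - {0..i} \<inter> {1}. fps_nth f k * (fps_nth (g ^ k) i - fps_nth (fps_X ^ k) i) = 0"
    proof
      fix k
      assume "k \<in> {0..i} - {0..i} \<inter> {1}"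
      then consider "k = 0" | "2 \<le> k"
        by force
      then show "fps_nth f k * (fps_nth (g ^ k) i - fps_nth (fps_X ^ k) i) = 0"
        by cases (use fps_nth_power_J_filtration[OF ga _ i] in simp_all)
    qed
  qed auto
  also have "\<dots> = fps_nth g i - fps_nth fps_X i"
    using f g by (cases "i = 0") (auto simp: carrier_J_group)
  finally show ?thesis
    by (simp add: algebra_simps)
qed

text \<open>
  Each coefficient of \<open>q\<close> in turn is compared by the previous lemma, whose hypothesis is what
  has been shown for the earlier coefficients.
\<close>

lemma J_filtration_left_factor:
  fixes q g :: "'a::comm_ring_1 fps"
  assumes q: "q \<in> carrier J_group" and g: "g \<in> carrier J_group"
    and eq: "\<And>i. i \<le> Suc b \<Longrightarrow> fps_nth (q oo g) i = fps_nth g i"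
  shows "q \<in> J_filtration b"
  using eq
proof (induction b)
  case 0
  then show ?case
    using q by (auto simp add: J_filtration_def carrier_J_group le_Suc_eq)
next
  case (Suc b)
  then have "q \<in> J_filtration b"
    by simp
  moreover from this have "fps_nth q (Suc (Suc b)) = fps_nth fps_X (Suc (Suc b))"
    using fps_nth_compose_J_filtration[OF q g, of b "Suc (Suc b)"] Suc.prems[of "Suc (Suc b)"]
    by (simp add: algebra_simps)
  ultimately show ?case
    by (simp add: J_filtration_Suc_iff)
qed

text \<open>
  This reduces the membership of inverses, commutators and quotients in the filtration to a
  comparison of coefficients of two products.
\<close>

lemma J_group_quotient_in_filtration:
  fixes f g :: "'a::comm_ring_1 fps"
  assumes f: "f \<in> carrier J_group" and g: "g \<in> carrier J_group"
    and eq: "\<And>i. i \<le> Suc b \<Longrightarrow> fps_nth f i = fps_nth g i"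
  shows "f \<otimes>\<^bsub>J_group\<^esub> inv\<^bsub>J_group\<^esub> g \<in> J_filtration b"
proof (rule J_filtration_left_factor)
  interpret group "J_group :: 'a fps monoid"
    by (rule group_J_group)
  show "f \<otimes>\<^bsub>J_group\<^esub> inv\<^bsub>J_group\<^esub> g \<in> carrier J_group"
    using f g by (simp del: mult_J_group)
  have "(f \<otimes>\<^bsub>J_group\<^esub> inv\<^bsub>J_group\<^esub> g) \<otimes>\<^bsub>J_group\<^esub> g = f"
    using f g by (simp del: mult_J_group one_J_group add: m_assoc)
  then show "fps_nth ((f \<otimes>\<^bsub>J_group\<^esub> inv\<^bsub>J_group\<^esub> g) oo g) i = fps_nth g i" if "i \<le> Suc b" for i
    using eq[OF that] by simp
qed (rule g)

lemma subgroup_J_filtration: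
  "subgroup (J_filtration a) (J_group :: 'a::comm_ring_1 fps monoid)"
proof -
  interpret group "J_group :: 'a fps monoid"
    by (rule group_J_group)
  have div: "f \<otimes>\<^bsub>J_group\<^esub> inv\<^bsub>J_group\<^esub> g \<in> J_filtration a"
    if "f \<in> J_filtration a" "g \<in> J_filtration a" for f g :: "'a fps"
    using that by (intro J_group_quotient_in_filtration) (auto simp: J_filtration_def)
  have X: "fps_X \<in> J_filtration a"
    by (simp add: J_filtration_def carrier_J_group)
  have inv: "inv\<^bsub>J_group\<^esub> g \<in> J_filtration a" if "g \<in> J_filtration a" for g :: "'a fps"
    using div[OF X that] l_one[OF inv_closed[OF J_filtration_carrier[OF that]]] by simp
  show ?thesis
  proof (rule subgroupI)
    fix f g :: "'a fps"
    assume "f \<in> J_filtration a" "g \<in> J_filtration a"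
    then show "f \<otimes>\<^bsub>J_group\<^esub> g \<in> J_filtration a"
      using div[of f "inv\<^bsub>J_group\<^esub> g"] inv J_filtration_carrier by fastforce
  qed (use X inv J_filtration_carrier in auto)
qed

lemma J_filtration_commutator:
  fixes f g :: "'a::comm_ring_1 fps"
  assumes "f \<in> J_filtration a" and "g \<in> carrier J_group"
  shows "commutator J_group f g \<in> J_filtration (Suc a)"
  unfolding commutator_def
proof (rule J_group_quotient_in_filtration)
  interpret group "J_group :: 'a fps monoid"
    by (rule group_J_group)
  note f = J_filtration_carrier[OF assms(1)]
  show "f \<otimes>\<^bsub>J_group\<^esub> g \<in> carrier J_group" "g \<otimes>\<^bsub>J_group\<^esub> f \<in> carrier J_group"
    using f assms(2) by (simp_all del: mult_J_group)
  show "fps_nth (f \<otimes>\<^bsub>J_group\<^esub> g) i = fps_nth (g \<otimes>\<^bsub>J_group\<^esub> f) i" if "i \<le> Suc (Suc a)" for i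
    using fps_nth_compose_J_filtration[OF f assms(2) _ that]
      fps_nth_compose_J_filtration[OF assms(2) f _ that] assms(1) by simp
qed

lemma J_filtration_nth_pow:
  fixes w :: "'a::comm_ring_1 fps"
  assumes w: "w \<in> J_filtration a"
  shows "w [^]\<^bsub>J_group\<^esub> j \<in> J_filtration a \<and>
    fps_nth (w [^]\<^bsub>J_group\<^esub> (j::nat)) (Suc (Suc a)) = of_nat j * fps_nth w (Suc (Suc a))"
proof (induction j)
  case 0
  interpret group "J_group :: 'a fps monoid"
    by (rule group_J_group)
  show ?case
    by (auto simp: J_filtration_def carrier_J_group)
next
  case (Suc j)
  interpret subgroup "J_filtration a" "J_group :: 'a fps monoid"
    by (rule subgroup_J_filtration)
  show ?case
    using Suc m_closed[of "w [^]\<^bsub>J_group\<^esub> j" w] w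
      fps_nth_compose_J_filtration[of "w [^]\<^bsub>J_group\<^esub> j" w a "Suc (Suc a)"]
    by (auto simp: nat_pow_def algebra_simps dest: J_filtration_carrier)
qed

text \<open>
  Modulo the next step of the filtration an element is determined by its coefficient of
  \<open>x^(a+2)\<close>, which a \<open>j\<close>-th power multiplies by \<open>j\<close>.
\<close>

lemma J_filtration_divisible_step:
  fixes x :: "'a::comm_ring_1 fps"
  assumes div: "\<And>c::'a. \<exists>d. of_nat j * d = c"
    and x: "x \<in> J_filtration a"
  shows "\<exists>w\<in>J_filtration a. x \<otimes>\<^bsub>J_group\<^esub> inv\<^bsub>J_group\<^esub> (w [^]\<^bsub>J_group\<^esub> j) \<in> J_filtration (Suc a)"
proof -
  obtain d where d: "of_nat j * d = fps_nth x (Suc (Suc a))"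
    using div by blast
  define w where "w = fps_X + fps_const d * fps_X ^ Suc (Suc a)"
  have w: "w \<in> J_filtration a"
    unfolding w_def by (auto simp: J_filtration_def carrier_J_group simp del: power_Suc)
  have wa: "fps_nth w (Suc (Suc a)) = d"
    by (simp add: w_def del: power_Suc)
  have pow: "w [^]\<^bsub>J_group\<^esub> j \<in> J_filtration a"
    "fps_nth (w [^]\<^bsub>J_group\<^esub> j) (Suc (Suc a)) = fps_nth x (Suc (Suc a))"
    using J_filtration_nth_pow[OF w, of j] d wa by auto
  have "x \<otimes>\<^bsub>J_group\<^esub> inv\<^bsub>J_group\<^esub> (w [^]\<^bsub>J_group\<^esub> j) \<in> J_filtration (Suc a)"
    by (rule J_group_quotient_in_filtration)
       (use x pow in \<open>auto simp: J_filtration_def le_Suc_eq\<close>)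
  with w show ?thesis
    by blast
qed

lemma fps_nth_one_plus_X_power:
  assumes "1 \<le> p"
  shows "fps_nth ((1 + fps_X ^ p) ^ q :: 'a::comm_ring_1 fps) p = of_nat q"
  using assms
  by (induction q) (simp_all add: distrib_right fps_X_power_mult_nth fps_power_zeroth zero_power)

lemma fps_X_power_compose:
  fixes g :: "'a::comm_ring_1 fps"
  assumes "fps_nth g 0 = 0"
  shows "fps_X ^ n oo g = g ^ n"
proof -
  have "fps_X oo g = g"
    using assms by (auto simp: fps_X_fps_compose intro!: fps_ext)
  then show ?thesis
    by (simp add: fps_compose_power_comm_ring[OF assms])
qed

text \<open>
  The series \<open>f = x + x^(n+2)\<close> and \<open>g = x + x^(n+3)\<close> do not commute: in degree \<open>2n+4\<close> the coefficient is
  \<open>n+2\<close> for \<open>f(g(x)) = g + g^(n+2)\<close> and \<open>n+3\<close> for \<open>g(f(x)) = f + f^(n+3)\<close>.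
\<close>

lemma J_filtration_noncommutative:
  "\<exists>f\<in>J_filtration n. \<exists>g\<in>J_filtration n. f oo g \<noteq> g oo (f :: 'a::comm_ring_1 fps)"
proof -
  define f g :: "'a fps" where "f = fps_X + fps_X ^ (n + 2)" and "g = fps_X + fps_X ^ (n + 3)"
  have mem: "f \<in> J_filtration n" "g \<in> J_filtration n"
    unfolding f_def g_def by (auto simp: J_filtration_def carrier_J_group simp del: power_Suc)
  have 0: "fps_nth f 0 = 0" "fps_nth g 0 = 0"
    by (simp_all add: f_def g_def)
  have "f oo g = g + g ^ (n + 2)"
    using 0 fps_X_power_compose[of g 1] fps_X_power_compose[of g "n + 2"]
    by (simp add: f_def fps_compose_add_distrib)
  moreover have "g = fps_X * (1 + fps_X ^ (n + 2))"
    by (simp add: g_def algebra_simps eval_nat_numeral)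
  ultimately have "f oo g = g + fps_X ^ (n + 2) * (1 + fps_X ^ (n + 2)) ^ (n + 2)"
    by (metis power_mult_distrib)
  then have fg: "fps_nth (f oo g) (2 * n + 4) = of_nat (n + 2)"
    using fps_nth_one_plus_X_power[of "n + 2" "n + 2", where 'a = 'a]
    by (simp add: g_def fps_X_power_mult_nth del: power_Suc of_nat_Suc)
  have "g oo f = f + f ^ (n + 3)"
    using 0 fps_X_power_compose[of f 1] fps_X_power_compose[of f "n + 3"]
    by (simp add: g_def fps_compose_add_distrib)
  moreover have "f = fps_X * (1 + fps_X ^ (n + 1))"
    by (simp add: f_def algebra_simps)
  ultimately have "g oo f = f + fps_X ^ (n + 3) * (1 + fps_X ^ (n + 1)) ^ (n + 3)"
    by (metis power_mult_distrib)
  then have "fps_nth (g oo f) (2 * n + 4) = of_nat (n + 3)"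
    using fps_nth_one_plus_X_power[of "n + 1" "n + 3", where 'a = 'a]
    by (simp add: f_def fps_X_power_mult_nth del: power_Suc of_nat_Suc)
  moreover have "of_nat (n + 3) = of_nat (n + 2) + (1 :: 'a)"
    by (simp add: algebra_simps)
  ultimately have "f oo g \<noteq> g oo f"
    using fg by (metis add_cancel_left_right zero_neq_one)
  with mem show ?thesis
    by blast
qed

section \<open>Continuous homomorphisms to locally compact groups\<close>

text \<open>
  A basic open set of the product constrains finitely many coefficients only. Series that agree with \<open>x\<close>
  in all of these satisfy the constraints.
\<close>

lemma J_filtration_neighbourhood:
  fixes W :: "'a::{comm_ring_1, topological_space} fps set"
  assumes "openin J_topology W" and "fps_X \<in> W"
  shows "\<exists>m. J_filtration m \<subseteq> W"
proof -
  let ?P = "product_topology (\<lambda>_. euclidean :: 'a topology) (UNIV :: nat set)"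
  obtain U where U: "openin ?P U" and W: "W = J_coeffs -` U \<inter> carrier J_group"
    using assms(1) unfolding J_topology_def openin_pullback_topology by blast
  have "J_coeffs fps_X \<in> U"
    using assms(2) W by blast
  then obtain B where B: "J_coeffs fps_X \<in> (\<Pi>\<^sub>E i\<in>UNIV. B i)"
    and fin: "finite {i. B i \<noteq> UNIV}" and sub: "(\<Pi>\<^sub>E i\<in>UNIV. B i) \<subseteq> U"
    using product_topology_open_contains_basis[OF U, of "J_coeffs fps_X"] by auto
  obtain m where m: "\<And>i. B i \<noteq> UNIV \<Longrightarrow> i < m"
    using finite_nat_set_iff_bounded[THEN iffD1, OF fin] by auto
  have "J_filtration m \<subseteq> W"
  proof
    fix f :: "'a fps"
    assume f: "f \<in> J_filtration m"
    have "J_coeffs f i \<in> B i" for i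
    proof (cases "i < m")
      case True
      then have "J_coeffs f i = J_coeffs fps_X i"
        using f by (simp add: J_coeffs_def J_filtration_def)
      then show ?thesis
        using B by auto
    qed (use m in blast)
    then show "f \<in> W"
      using sub W J_filtration_carrier[OF f] by auto
  qed
  then show ?thesis
    by blast
qed

theorem theorem2:
  fixes \<iota> :: "rat \<Rightarrow> 'k::{comm_ring_1, topological_ab_group_add, topological_semigroup_mult}"
  assumes "inj \<iota>" and "\<iota> 1 = 1"
    and "\<And>p q. \<iota> (p + q) = \<iota> p + \<iota> q"
    and "\<And>p q. \<iota> (p * q) = \<iota> p * \<iota> q"
  shows "\<not> (\<exists>(H :: 'h monoid) T. locally_compact_group H T \<and>
    admits_continuous_bijection (J_group :: 'k fps monoid) J_topology H T)"
proof
  assume "\<exists>(H :: 'h monoid) T. locally_compact_group H T \<and>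
    admits_continuous_bijection (J_group :: 'k fps monoid) J_topology H T"
  then obtain H :: "'h monoid" and T \<phi> where H: "locally_compact_group H T"
    and hom: "\<phi> \<in> hom (J_group :: 'k fps monoid) H" and cont: "continuous_map J_topology T \<phi>"
    and inj: "inj_on \<phi> (carrier J_group)"
    unfolding admits_continuous_bijection_def by blast
  have H': "group H" "topspace T = carrier H"
    using H by (simp_all add: locally_compact_group_def topological_group_def)
  interpret \<phi>: group_hom "J_group :: 'k fps monoid" H \<phi>
    using hom H' by (simp add: group_hom_def group_hom_axioms_def group_J_group)
  have \<iota>0: "\<iota> 0 = 0"
    using assms(3)[of 0 0] by simp
  have \<iota>_nat: "\<iota> (of_nat j) = of_nat j" for j
    by (induction j) (simp_all add: \<iota>0 assms(2,3))
  have divide: "\<exists>d. of_nat j * d = c" if "0 < j" for j :: nat and c :: 'k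
  proof
    have "of_nat j * \<iota> (1 / of_nat j) = \<iota> (of_nat j * (1 / of_nat j))"
      by (simp only: assms(4) \<iota>_nat)
    then have "of_nat j * \<iota> (1 / of_nat j) = 1"
      using that assms(2) by simp
    then show "of_nat j * (\<iota> (1 / of_nat j) * c) = c"
      by (simp flip: mult.assoc)
  qed
  have small: "\<exists>m. \<phi> ` J_filtration m \<subseteq> U" if U: "openin T U" "\<one>\<^bsub>H\<^esub> \<in> U" for U
  proof -
    have "openin J_topology {f \<in> topspace J_topology. \<phi> f \<in> U}"
      using cont U(1) by (rule openin_continuous_map_preimage)
    moreover have "fps_X \<in> {f \<in> topspace J_topology. \<phi> f \<in> U}"
      using U(2) \<phi>.hom_one
      by (simp add: J_topology_def topspace_pullback_topology carrier_J_group)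
    ultimately obtain m where "J_filtration m \<subseteq> {f \<in> topspace J_topology. \<phi> f \<in> U}"
      using J_filtration_neighbourhood by blast
    then show ?thesis
      by blast
  qed
  obtain n where n: "\<And>f g. f \<in> J_filtration n \<Longrightarrow> g \<in> J_filtration n \<Longrightarrow>
      \<phi> (f \<otimes>\<^bsub>J_group\<^esub> g) = \<phi> (g \<otimes>\<^bsub>J_group\<^esub> f)"
    using filtration_eventually_commutes[OF group_J_group H hom subgroup_J_filtration
        J_filtration_commutator J_filtration_Suc_subset J_filtration_divisible_step[OF divide] small]
    by blast
  obtain f g :: "'k fps" where f: "f \<in> J_filtration n" and g: "g \<in> J_filtration n"
    and fg: "f oo g \<noteq> g oo f"
    using J_filtration_noncommutative by blast
  have "f \<otimes>\<^bsub>J_group\<^esub> g = g \<otimes>\<^bsub>J_group\<^esub> f"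
    using inj n[OF f g] J_filtration_carrier[OF f] J_filtration_carrier[OF g]
    by (meson \<phi>.G.m_closed inj_onD)
  with fg show False
    by simp
qed

end
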